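(* Let $\mathfrak{X}=(X,\{R_r\}_{r=0}^d)$ be a formally self-dual association scheme that is $P$-polynomial (and hence $Q$-polynomial), with base vertex $u_0$, and suppose $\mathrm{Hom}_0(X)+\mathrm{Hom}_1(X)=L_0(X)+L_1(X)$. If $d\ge 6$, then $\mathfrak{X}$ is (isomorphic to) the Hamming scheme $H(d,q)$ for some $q$.
   Context: $A_0,\dots,A_d$ are the adjacency matrices in a $P$-polynomial ordering ($(X,R_1)$ distance-regular with $R_i$ its distance-$i$ relation). Formally self-dual: there is an ordering $E_0,\dots,E_d$ of the primitive idempotents such that the first eigenmatrix $P$ (defined by $A_j=\sum_i P_{ij}E_i$) equals the second eigenmatrix $Q$ (defined by $E_j=|X|^{-1}\sum_i Q_{ij}A_i$); this ordering is then $Q$-polynomial, and $L_j(X)$ denotes the column space of $E_j$ (as functions on $X$). Shells $X_r=\{x:(u_0,x)\in R_r\}$. For $z\in X_j$, $f_z(x)=1$ if $x\in X_i$ with $i\ge j$ and $(x,z)\in R_{i-j}$, $f_z(x)=0$ otherwise; $\mathrm{Hom}_j(X)=\mathrm{span}\{f_z: z\in X_j\}$. The Hamming scheme $H(d,q)$ has vertex set $\{0,\dots,q-1\}^d$ with $R_r$ = "differ in exactly $r$ coordinates". *)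

theory Defs
  imports Complex_Main
begin

text \<open>A scheme on the finite vertex set X with d classes is given by the class-index
function rel: rel x y = r means (x,y) in R_r.\<close>

definition assoc_scheme :: "'a set \<Rightarrow> nat \<Rightarrow> ('a \<Rightarrow> 'a \<Rightarrow> nat) \<Rightarrow> bool" where
  "assoc_scheme X d rel \<longleftrightarrow>
     finite X \<and> X \<noteq> {} \<and>
     (\<forall>x\<in>X. \<forall>y\<in>X. rel x y \<le> d) \<and>
     (\<forall>x\<in>X. \<forall>y\<in>X. rel x y = 0 \<longleftrightarrow> x = y) \<and>
     (\<forall>r\<le>d. \<exists>x\<in>X. \<exists>y\<in>X. rel x y = r) \<and>
     (\<forall>r\<le>d. \<exists>r'\<le>d. \<forall>x\<in>X. \<forall>y\<in>X. rel x y = r \<longleftrightarrow> rel y x = r') \<and>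
     (\<forall>i\<le>d. \<forall>j\<le>d. \<forall>k\<le>d. \<exists>p. \<forall>x\<in>X. \<forall>y\<in>X. rel x y = k \<longrightarrow>
        card {z\<in>X. rel x z = i \<and> rel z y = j} = p)"

fun walk :: "'a set \<Rightarrow> ('a \<Rightarrow> 'a \<Rightarrow> nat) \<Rightarrow> nat \<Rightarrow> 'a \<Rightarrow> 'a \<Rightarrow> bool" where
  "walk X rel 0 x y = (x = y)"
| "walk X rel (Suc n) x y = (\<exists>z\<in>X. rel x z = 1 \<and> walk X rel n z y)"

definition P_polynomial :: "'a set \<Rightarrow> nat \<Rightarrow> ('a \<Rightarrow> 'a \<Rightarrow> nat) \<Rightarrow> bool" where
  "P_polynomial X d rel \<longleftrightarrow> assoc_scheme X d rel \<and>
     (\<forall>x\<in>X. \<forall>y\<in>X. walk X rel (rel x y) x y \<and> (\<forall>n < rel x y. \<not> walk X rel n x y))"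

definition mmult :: "'a set \<Rightarrow> ('a \<Rightarrow> 'a \<Rightarrow> real) \<Rightarrow> ('a \<Rightarrow> 'a \<Rightarrow> real) \<Rightarrow> 'a \<Rightarrow> 'a \<Rightarrow> real" where
  "mmult X M N x y = (\<Sum>z\<in>X. M x z * N z y)"

definition adj :: "('a \<Rightarrow> 'a \<Rightarrow> nat) \<Rightarrow> nat \<Rightarrow> 'a \<Rightarrow> 'a \<Rightarrow> real" where
  "adj rel j x y = (if rel x y = j then 1 else 0)"

text \<open>E_0..E_d are the primitive idempotents of the Bose-Mesner algebra (d+1 nonzero
mutually orthogonal idempotents summing to I), with first eigenmatrix P
(A_j = sum_i P_ij E_i) equal to the second eigenmatrix Q (E_j = |X|^-1 sum_i Q_ij A_i).\<close>
definition formally_self_dual_ordering ::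
  "'a set \<Rightarrow> nat \<Rightarrow> ('a \<Rightarrow> 'a \<Rightarrow> nat) \<Rightarrow> (nat \<Rightarrow> 'a \<Rightarrow> 'a \<Rightarrow> real) \<Rightarrow> (nat \<Rightarrow> nat \<Rightarrow> real) \<Rightarrow> bool" where
  "formally_self_dual_ordering X d rel E P \<longleftrightarrow>
     (\<forall>i\<le>d. \<forall>j\<le>d. \<forall>x\<in>X. \<forall>y\<in>X. mmult X (E i) (E j) x y = (if i = j then E i x y else 0)) \<and>
     (\<forall>x\<in>X. \<forall>y\<in>X. (\<Sum>i\<le>d. E i x y) = (if x = y then 1 else 0)) \<and>
     (\<forall>i\<le>d. \<exists>x\<in>X. \<exists>y\<in>X. E i x y \<noteq> 0) \<and>
     (\<forall>j\<le>d. \<forall>x\<in>X. \<forall>y\<in>X. adj rel j x y = (\<Sum>i\<le>d. P i j * E i x y)) \<and>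
     (\<forall>j\<le>d. \<forall>x\<in>X. \<forall>y\<in>X. E j x y = (1 / real (card X)) * (\<Sum>i\<le>d. P i j * adj rel i x y))"

text \<open>Functions on X are represented as functions vanishing outside X.\<close>
definition Lspace :: "'a set \<Rightarrow> (nat \<Rightarrow> 'a \<Rightarrow> 'a \<Rightarrow> real) \<Rightarrow> nat \<Rightarrow> ('a \<Rightarrow> real) set" where
  "Lspace X E j = {f. (\<forall>x. x \<notin> X \<longrightarrow> f x = 0) \<and>
                     (\<exists>v. \<forall>x\<in>X. f x = (\<Sum>y\<in>X. E j x y * v y))}"

definition fz :: "'a set \<Rightarrow> ('a \<Rightarrow> 'a \<Rightarrow> nat) \<Rightarrow> 'a \<Rightarrow> 'a \<Rightarrow> 'a \<Rightarrow> real" where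
  "fz X rel u0 z x = (if x \<in> X \<and> rel u0 z \<le> rel u0 x \<and> rel x z = rel u0 x - rel u0 z then 1 else 0)"

definition Hom :: "'a set \<Rightarrow> ('a \<Rightarrow> 'a \<Rightarrow> nat) \<Rightarrow> 'a \<Rightarrow> nat \<Rightarrow> ('a \<Rightarrow> real) set" where
  "Hom X rel u0 j = {f. \<exists>c. f = (\<lambda>x. \<Sum>z\<in>{z\<in>X. rel u0 z = j}. c z * fz X rel u0 z x)}"

definition subspace_sum :: "('a \<Rightarrow> real) set \<Rightarrow> ('a \<Rightarrow> real) set \<Rightarrow> ('a \<Rightarrow> real) set" where
  "subspace_sum U W = {(\<lambda>x. f x + g x) | f g. f \<in> U \<and> g \<in> W}"

definition iso_Hamming :: "'a set \<Rightarrow> nat \<Rightarrow> ('a \<Rightarrow> 'a \<Rightarrow> nat) \<Rightarrow> nat \<Rightarrow> bool" where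
  "iso_Hamming X d rel q \<longleftrightarrow>
     (\<exists>\<phi>. bij_betw \<phi> X {w :: nat list. length w = d \<and> set w \<subseteq> {..<q}} \<and>
          (\<forall>x\<in>X. \<forall>y\<in>X. rel x y = card {i. i < d \<and> \<phi> x ! i \<noteq> \<phi> y ! i}))"

end

theory Submission
  imports Defs
begin

text \<open>Let \<open>S\<close> be the set of neighbours of \<open>u0\<close>, and for \<open>z \<in> S\<close> let \<open>Y z\<close> be the set of vertices that
  are closer to \<open>z\<close> than to \<open>u0\<close>, so that \<open>f\<^sub>z\<close> is its indicator. Since \<open>f\<^sub>z\<close> is a constant plus an
  eigenvector, every vertex outside \<open>Y z\<close> has exactly one neighbour in \<open>Y z\<close>, and every vertex inside
  has \<open>b\<^sub>1\<close> of them. Evaluating this near \<open>u0\<close> shows that \<open>c\<^sub>2 = 2\<close>, that \<open>S\<close> is a disjoint union of cliques of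
  size \<open>q - 1\<close>, and that the first three eigenvalues are \<open>k\<close>, \<open>k - q\<close>, \<open>k - 2q\<close>. By self-duality these
  are also the entries of \<open>|X| E\<^sub>1\<close>. The centred \<open>f\<^sub>z\<close> form a basis of the eigenspace \<open>L\<^sub>1\<close>, dual
  to the differences of kernel functions \<open>E\<^sub>1(\<cdot>, z) - E\<^sub>1(\<cdot>, u0)\<close>, whose Gram matrix is thus known.
  Inverting it shows that the \<open>Y z\<close> with \<open>z\<close> in one clique are disjoint, so each clique gives a
  coordinate with \<open>q\<close> values, and that adjacent vertices differ in exactly one coordinate. The coordinates
  therefore form a covering map onto a Hamming graph; its fibre over the image of \<open>u0\<close> is a single
  point, so it is an isomorphism.\<close>

section \<open>Coordinates that cover a Hamming graph\<close>

lemma walk_append: "walk X rel n x y \<Longrightarrow> y \<in> X \<Longrightarrow> z \<in> X \<Longrightarrow> rel y z = 1 \<Longrightarrow> walk X rel (Suc n) x z"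
  by (induction n arbitrary: x) auto

lemma sum_card_swap:
  assumes "finite A" "finite B"
  shows "(\<Sum>x\<in>A. card {y\<in>B. R x y}) = (\<Sum>y\<in>B. card {x\<in>A. R x y})"
proof -
  have "(\<Sum>x\<in>A. card {y\<in>B. R x y}) = (\<Sum>x\<in>A. \<Sum>y\<in>B. if R x y then 1 else 0)"
    using assms by (simp flip: sum.inter_filter)
  also have "\<dots> = (\<Sum>y\<in>B. \<Sum>x\<in>A. if R x y then 1 else 0)"
    by (rule sum.swap)
  also have "\<dots> = (\<Sum>y\<in>B. card {x\<in>A. R x y})"
    using assms by (simp flip: sum.inter_filter)
  finally show ?thesis .
qed

text \<open>\<open>walk_rel\<close> and \<open>rel_le_walk\<close> make \<open>rel\<close> the graph
  distance. \<open>edge\<close> and \<open>step_ex1\<close> say that edges of the Hamming graph lift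
  uniquely, and \<open>base_unique\<close> makes the fibre over the image of \<open>u0\<close>
  trivial.\<close>

locale hamming_coordinates =
  fixes X :: "'a set" and rel :: "'a \<Rightarrow> 'a \<Rightarrow> nat" and u0 :: 'a
    and m q :: nat and dig :: "nat \<Rightarrow> 'a \<Rightarrow> nat"
  assumes base: "u0 \<in> X"
    and walk_rel: "\<And>x y. x \<in> X \<Longrightarrow> y \<in> X \<Longrightarrow> walk X rel (rel x y) x y"
    and rel_le_walk: "\<And>x y n. x \<in> X \<Longrightarrow> y \<in> X \<Longrightarrow> walk X rel n x y \<Longrightarrow> rel x y \<le> n"
    and rel_sym: "\<And>x y. x \<in> X \<Longrightarrow> y \<in> X \<Longrightarrow> rel x y = rel y x"
    and dig_less: "\<And>x i. x \<in> X \<Longrightarrow> i < m \<Longrightarrow> dig i x < q"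
    and edge: "\<And>x y. x \<in> X \<Longrightarrow> y \<in> X \<Longrightarrow> rel x y = 1 \<Longrightarrow> card {i. i < m \<and> dig i x \<noteq> dig i y} = 1"
    and step_ex1: "\<And>x i b. x \<in> X \<Longrightarrow> i < m \<Longrightarrow> b < q \<Longrightarrow> b \<noteq> dig i x \<Longrightarrow>
                     \<exists>!y. y \<in> X \<and> rel x y = 1 \<and> dig i y = b"
    and base_unique: "\<And>y. y \<in> X \<Longrightarrow> (\<And>i. i < m \<Longrightarrow> dig i y = dig i u0) \<Longrightarrow> y = u0"
begin

definition ham :: "'a \<Rightarrow> 'a \<Rightarrow> nat" where
  "ham x y = card {i. i < m \<and> dig i x \<noteq> dig i y}"

lemma edge_only:
  assumes "x \<in> X" "y \<in> X" "rel x y = 1" "i < m" "dig i x \<noteq> dig i y" "j < m" "j \<noteq> i"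
  shows "dig j x = dig j y"
proof -
  obtain k where "{i. i < m \<and> dig i x \<noteq> dig i y} = {k}"
    using edge[OF assms(1-3)] card_1_singletonE by blast
  then have "i = k" "dig j x \<noteq> dig j y \<Longrightarrow> j = k" using assms(4-6) by blast+
  then show ?thesis using assms(7) by metis
qed

lemma edge_differs:
  assumes "x \<in> X" "y \<in> X" "rel x y = 1"
  obtains i where "i < m" "dig i x \<noteq> dig i y"
proof -
  obtain k where "{i. i < m \<and> dig i x \<noteq> dig i y} = {k}"
    using edge[OF assms] card_1_singletonE by blast
  then show ?thesis using that by blast
qed

text \<open>The digits form a covering map onto the Hamming graph. Lifting a walk from \<open>x\<close> to
  \<open>u0\<close> to a second point of the fibre forces that point to equal \<open>x\<close>.\<close>
lemma dig_inj_walk: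
  "walk X rel n x u0 \<Longrightarrow> x \<in> X \<Longrightarrow> y \<in> X \<Longrightarrow> (\<And>i. i < m \<Longrightarrow> dig i y = dig i x) \<Longrightarrow> y = x"
proof (induction n arbitrary: x y)
  case 0
  then show ?case using base_unique by simp
next
  case (Suc n)
  then obtain z where z: "z \<in> X" "rel x z = 1" "walk X rel n z u0" by auto
  obtain i where i: "i < m" "dig i x \<noteq> dig i z" using edge_differs[OF Suc.prems(2) z(1,2)] .
  have "\<exists>!y'. y' \<in> X \<and> rel y y' = 1 \<and> dig i y' = dig i z"
    by (intro step_ex1) (use i z(1) Suc.prems dig_less in auto)
  then obtain y' where y': "y' \<in> X" "rel y y' = 1" "dig i y' = dig i z" by blast
  \<comment> \<open>Both steps change digit \<open>i\<close> only, and to the same value, so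
    \<open>y'\<close> lies in the fibre of \<open>z\<close>, where the induction hypothesis
    applies.\<close>
  have "dig j y' = dig j z" if "j < m" for j
    using edge_only[of x z i j] edge_only[of y y' i j] i that y' z Suc.prems by (cases "j = i") auto
  then have "y' = z" using Suc.IH z y' by blast
  then have zy: "rel z y = 1" "rel z x = 1"
    using y' z rel_sym[of z y] rel_sym[of z x] Suc.prems by simp_all
  \<comment> \<open>\<open>x\<close> and \<open>y\<close> are both neighbours of \<open>z\<close>
    carrying the \<open>i\<close>-th digit of \<open>x\<close>, so unique lifting identifies
    them.\<close>
  have "\<exists>!w. w \<in> X \<and> rel z w = 1 \<and> dig i w = dig i x"
    by (intro step_ex1) (use i z(1) Suc.prems dig_less in auto)
  then show ?case using zy Suc.prems i(1) by blast
qed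

lemma dig_inj:
  assumes "x \<in> X" "y \<in> X" "\<And>i. i < m \<Longrightarrow> dig i y = dig i x"
  shows "y = x"
  by (rule dig_inj_walk[OF walk_rel[OF assms(1) base] assms])

text \<open>Digits are corrected one at a time starting from \<open>u0\<close>; a step that changes
  digit \<open>j\<close> leaves the earlier ones intact.\<close>

lemma dig_surj_prefix:
  assumes "\<And>i. i < m \<Longrightarrow> w i < q"
  shows "j \<le> m \<Longrightarrow> \<exists>x\<in>X. \<forall>i<j. dig i x = w i"
proof (induction j)
  case 0
  then show ?case using base by auto
next
  case (Suc j)
  then obtain x where x: "x \<in> X" "\<forall>i<j. dig i x = w i" by auto
  show ?case
  proof (cases "dig j x = w j")
    case True
    then show ?thesis using x less_Suc_eq by auto
  next
    case False
    then obtain y where y: "y \<in> X" "rel x y = 1" "dig j y = w j"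
      using step_ex1[of x j "w j"] x assms Suc.prems by (metis Suc_le_eq)
    have "dig i y = w i" if "i < Suc j" for i
      using that edge_only[of x y j i] x y False Suc.prems by (cases "i = j") auto
    then show ?thesis using y by blast
  qed
qed

lemma ham_le_walk: "walk X rel n x y \<Longrightarrow> x \<in> X \<Longrightarrow> y \<in> X \<Longrightarrow> ham x y \<le> n"
proof (induction n arbitrary: x)
  case 0
  then show ?case by (simp add: ham_def)
next
  case (Suc n)
  then obtain z where z: "z \<in> X" "rel x z = 1" "walk X rel n z y" by auto
  have "ham x y \<le> card ({i. i < m \<and> dig i x \<noteq> dig i z} \<union> {i. i < m \<and> dig i z \<noteq> dig i y})"
    unfolding ham_def by (rule card_mono) auto
  also have "\<dots> \<le> 1 + ham z y"
    unfolding ham_def edge[OF Suc.prems(2) z(1,2), symmetric] by (rule card_Un_le)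
  also have "\<dots> \<le> Suc n" using Suc.IH z Suc.prems by simp
  finally show ?case .
qed

text \<open>Each step corrects one differing digit; injectivity of the digits ends the walk at
  \<open>y\<close> itself.\<close>

lemma walk_ham: "ham x y = n \<Longrightarrow> x \<in> X \<Longrightarrow> y \<in> X \<Longrightarrow> walk X rel n x y"
proof (induction n arbitrary: x)
  case 0
  then have "{i. i < m \<and> dig i x \<noteq> dig i y} = {}" by (simp add: ham_def)
  then show ?case using dig_inj[of x y] 0 by auto
next
  case (Suc n)
  then have "{i. i < m \<and> dig i x \<noteq> dig i y} \<noteq> {}"
    unfolding ham_def by (metis card.empty Suc_neq_Zero)
  then obtain i where i: "i < m" "dig i x \<noteq> dig i y" by auto
  then obtain z where z: "z \<in> X" "rel x z = 1" "dig i z = dig i y"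
    using step_ex1[of x i "dig i y"] Suc.prems dig_less by force
  have "{j. j < m \<and> dig j z \<noteq> dig j y} = {j. j < m \<and> dig j x \<noteq> dig j y} - {i}"
    using edge_only[OF Suc.prems(2) z(1,2) i(1)] z(3) i by fastforce
  then have "ham z y = n" using Suc.prems i by (simp add: ham_def)
  then show ?case using Suc.IH z Suc.prems by auto
qed

lemma rel_eq_ham: "x \<in> X \<Longrightarrow> y \<in> X \<Longrightarrow> rel x y = ham x y"
  using ham_le_walk[OF walk_rel] rel_le_walk[OF _ _ walk_ham[OF refl]] by (intro le_antisym)

lemma iso_Hamming: "iso_Hamming X m rel q"
proof -
  define \<phi> where "\<phi> x = map (\<lambda>i. dig i x) [0..<m]" for x
  have "inj_on \<phi> X"
    using dig_inj by (auto simp: inj_on_def \<phi>_def)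
  moreover have "\<phi> ` X = {w. length w = m \<and> set w \<subseteq> {..<q}}"
  proof
    show "\<phi> ` X \<subseteq> {w. length w = m \<and> set w \<subseteq> {..<q}}"
      using dig_less by (auto simp: \<phi>_def)
    show "{w. length w = m \<and> set w \<subseteq> {..<q}} \<subseteq> \<phi> ` X"
    proof
      fix w assume w: "w \<in> {w. length w = m \<and> set w \<subseteq> {..<q}}"
      then have "\<And>i. i < m \<Longrightarrow> w ! i < q" using nth_mem by fastforce
      then obtain x where "x \<in> X" "\<forall>i<m. dig i x = w ! i"
        using dig_surj_prefix[of "\<lambda>i. w ! i" m] by auto
      then show "w \<in> \<phi> ` X"
        using w by (intro image_eqI[of _ _ x]) (auto simp: \<phi>_def intro: nth_equalityI)
    qed
  qed
  moreover have "rel x y = card {i. i < m \<and> \<phi> x ! i \<noteq> \<phi> y ! i}" if "x \<in> X" "y \<in> X" for x y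
  proof -
    have "{i. i < m \<and> \<phi> x ! i \<noteq> \<phi> y ! i} = {i. i < m \<and> dig i x \<noteq> dig i y}"
      by (auto simp: \<phi>_def)
    then show ?thesis using rel_eq_ham that by (simp add: ham_def)
  qed
  ultimately show ?thesis
    unfolding iso_Hamming_def bij_betw_def by blast
qed

end

section \<open>Self-dual schemes with homogeneous first eigenspace\<close>

declare One_nat_def [simp del]

locale homogeneous_self_dual =
  fixes X :: "'a set" and d :: nat and rel :: "'a \<Rightarrow> 'a \<Rightarrow> nat" and u0 :: 'a
    and E :: "nat \<Rightarrow> 'a \<Rightarrow> 'a \<Rightarrow> real" and P :: "nat \<Rightarrow> nat \<Rightarrow> real"
  assumes poly: "P_polynomial X d rel"
    and dual: "formally_self_dual_ordering X d rel E P"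
    and base: "u0 \<in> X"
    and hom: "subspace_sum (Hom X rel u0 0) (Hom X rel u0 1) = subspace_sum (Lspace X E 0) (Lspace X E 1)"
    and diam: "2 \<le> d"
begin

section \<open>Scheme axioms, idempotents and symmetry\<close>

lemma scheme: "assoc_scheme X d rel"
  using poly by (simp add: P_polynomial_def)

lemma finX [simp]: "finite X"
  and rel_le: "x \<in> X \<Longrightarrow> y \<in> X \<Longrightarrow> rel x y \<le> d"
  and rel_0: "x \<in> X \<Longrightarrow> y \<in> X \<Longrightarrow> rel x y = 0 \<longleftrightarrow> x = y"
  and rel_occurs: "r \<le> d \<Longrightarrow> \<exists>x\<in>X. \<exists>y\<in>X. rel x y = r"
  and rel_transpose: "r \<le> d \<Longrightarrow> \<exists>r'\<le>d. \<forall>x\<in>X. \<forall>y\<in>X. rel x y = r \<longleftrightarrow> rel y x = r'"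
  using scheme unfolding assoc_scheme_def by simp_all

lemma intersection_number:
  assumes "i \<le> d" "j \<le> d" "k \<le> d"
  obtains p where "\<And>x y. x \<in> X \<Longrightarrow> y \<in> X \<Longrightarrow> rel x y = k \<Longrightarrow>
    card {z\<in>X. rel x z = i \<and> rel z y = j} = p"
proof -
  have "\<forall>i\<le>d. \<forall>j\<le>d. \<forall>k\<le>d. \<exists>p. \<forall>x\<in>X. \<forall>y\<in>X. rel x y = k \<longrightarrow>
      card {z\<in>X. rel x z = i \<and> rel z y = j} = p"
    using scheme unfolding assoc_scheme_def by (elim conjE)
  then have "\<exists>p. \<forall>x\<in>X. \<forall>y\<in>X. rel x y = k \<longrightarrow> card {z\<in>X. rel x z = i \<and> rel z y = j} = p"
    using assms by simp
  then show ?thesis using that by auto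
qed

lemma walk_rel: "x \<in> X \<Longrightarrow> y \<in> X \<Longrightarrow> walk X rel (rel x y) x y"
  and rel_le_walk: "x \<in> X \<Longrightarrow> y \<in> X \<Longrightarrow> walk X rel n x y \<Longrightarrow> rel x y \<le> n"
  using poly unfolding P_polynomial_def by (simp, force simp: not_less[symmetric])

lemma rel_step: "x \<in> X \<Longrightarrow> y \<in> X \<Longrightarrow> z \<in> X \<Longrightarrow> rel y z = 1 \<Longrightarrow> rel x z \<le> Suc (rel x y)"
  by (rule rel_le_walk[OF _ _ walk_append[OF walk_rel]])

lemma X_nonempty [simp]: "X \<noteq> {}"
  using base by auto

lemma card_pos: "real (card X) > 0"
  by (simp add: card_gt_0_iff)

lemma E_mult: "i \<le> d \<Longrightarrow> j \<le> d \<Longrightarrow> x \<in> X \<Longrightarrow> y \<in> X \<Longrightarrow>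
    (\<Sum>z\<in>X. E i x z * E j z y) = (if i = j then E i x y else 0)"
  and E_nonzero: "i \<le> d \<Longrightarrow> \<exists>x\<in>X. \<exists>y\<in>X. E i x y \<noteq> 0"
  and adj_eq: "j \<le> d \<Longrightarrow> x \<in> X \<Longrightarrow> y \<in> X \<Longrightarrow> adj rel j x y = (\<Sum>i\<le>d. P i j * E i x y)"
proof -
  have "\<forall>i\<le>d. \<forall>j\<le>d. \<forall>x\<in>X. \<forall>y\<in>X. mmult X (E i) (E j) x y = (if i = j then E i x y else 0)"
    using dual unfolding formally_self_dual_ordering_def by (elim conjE)
  then show "i \<le> d \<Longrightarrow> j \<le> d \<Longrightarrow> x \<in> X \<Longrightarrow> y \<in> X \<Longrightarrow>
      (\<Sum>z\<in>X. E i x z * E j z y) = (if i = j then E i x y else 0)"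
    by (simp add: mmult_def)
  have "\<forall>i\<le>d. \<exists>x\<in>X. \<exists>y\<in>X. E i x y \<noteq> 0"
    using dual unfolding formally_self_dual_ordering_def by (elim conjE)
  then show "i \<le> d \<Longrightarrow> \<exists>x\<in>X. \<exists>y\<in>X. E i x y \<noteq> 0" by simp
  have "\<forall>j\<le>d. \<forall>x\<in>X. \<forall>y\<in>X. adj rel j x y = (\<Sum>i\<le>d. P i j * E i x y)"
    using dual unfolding formally_self_dual_ordering_def by (elim conjE)
  then show "j \<le> d \<Longrightarrow> x \<in> X \<Longrightarrow> y \<in> X \<Longrightarrow> adj rel j x y = (\<Sum>i\<le>d. P i j * E i x y)"
    by simp
qed

text \<open>Self-duality enters here: the entries of |X| \<open>E j\<close> are entries of the same
  matrix \<open>P\<close> that holds the eigenvalues.\<close>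

lemma E_eq:
  assumes "j \<le> d" "x \<in> X" "y \<in> X"
  shows "E j x y = P (rel x y) j / real (card X)"
proof -
  have "E j x y = (1 / real (card X)) * (\<Sum>i\<le>d. P i j * adj rel i x y)"
    using dual assms unfolding formally_self_dual_ordering_def by (elim conjE) simp
  also have "(\<Sum>i\<le>d. P i j * adj rel i x y) = (\<Sum>i\<le>d. if i = rel x y then P i j else 0)"
    by (intro sum.cong) (auto simp: adj_def)
  also have "\<dots> = P (rel x y) j" using rel_le assms by simp
  finally show ?thesis by simp
qed

lemma comb_mult_E:
  assumes "i \<le> d" "x \<in> X" "y \<in> X" and M: "\<And>z. z \<in> X \<Longrightarrow> M z = (\<Sum>l\<le>d. c l * E l x z)"
  shows "(\<Sum>z\<in>X. M z * E i z y) = c i * E i x y"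
proof -
  have "(\<Sum>z\<in>X. M z * E i z y) = (\<Sum>z\<in>X. \<Sum>l\<le>d. c l * (E l x z * E i z y))"
    using M by (intro sum.cong) (auto simp: sum_distrib_right mult.assoc)
  also have "\<dots> = (\<Sum>l\<le>d. c l * (\<Sum>z\<in>X. E l x z * E i z y))"
    by (subst sum.swap) (simp add: sum_distrib_left)
  also have "\<dots> = (\<Sum>l\<le>d. if l = i then c i * E i x y else 0)"
    using assms by (intro sum.cong) (auto simp: E_mult)
  finally show ?thesis using assms by simp
qed

lemma adj_mult_E:
  assumes "i \<le> d" "j \<le> d" "x \<in> X" "y \<in> X"
  shows "(\<Sum>z\<in>X. adj rel j x z * E i z y) = P i j * E i x y"
  using comb_mult_E[of i x y "adj rel j x" "\<lambda>l. P l j"] assms adj_eq by simp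

lemma P_i0:
  assumes "i \<le> d"
  shows "P i 0 = 1"
proof -
  obtain x y where xy: "x \<in> X" "y \<in> X" "E i x y \<noteq> 0" using E_nonzero assms by blast
  have "(\<Sum>z\<in>X. adj rel 0 x z * E i z y) = (\<Sum>z\<in>X. if z = x then E i x y else 0)"
    using xy rel_0 by (intro sum.cong) (auto simp: adj_def)
  then show ?thesis using adj_mult_E[of i 0 x y] xy assms by simp
qed

text \<open>Column 0 of \<open>P\<close> is constant because \<open>A_0\<close> is the identity; by
  duality \<open>E 0\<close> is the averaging matrix, so \<open>L_0\<close> consists of
  constants.\<close>

lemma E_0: "x \<in> X \<Longrightarrow> y \<in> X \<Longrightarrow> E 0 x y = 1 / real (card X)"
  using E_eq[of 0 x y] P_i0 rel_le by simp

text \<open>Row sums of \<open>A_j\<close> are read off by multiplying with the constant matrix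
  \<open>E 0\<close>.\<close>

lemma valency:
  assumes "j \<le> d" "x \<in> X"
  shows "real (card {z\<in>X. rel x z = j}) = P 0 j"
proof -
  have "(\<Sum>z\<in>X. adj rel j x z * E 0 z x) = P 0 j * E 0 x x"
    using adj_mult_E assms by simp
  then have "(\<Sum>z\<in>X. adj rel j x z) / real (card X) = P 0 j / real (card X)"
    using assms by (simp add: E_0 sum_divide_distrib)
  moreover have "(\<Sum>z\<in>X. adj rel j x z) = real (card {z\<in>X. rel x z = j})"
    by (simp add: adj_def flip: sum.inter_filter)
  ultimately show ?thesis by simp
qed

text \<open>The definition of a scheme also admits non-symmetric relations. They are excluded because
  \<open>M = A\<^sub>r - A\<^sub>r\<^sup>T\<close> is a real combination of the idempotents, so that \<open>M\<^sup>2\<close> has a non-negative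
  diagonal, while \<open>M\<^sup>2 = - M M\<^sup>T\<close>.\<close>
lemma rel_sym:
  assumes "x \<in> X" "y \<in> X"
  shows "rel x y = rel y x"
proof -
  define r where "r = rel x y"
  have r: "r \<le> d" using rel_le assms by (simp add: r_def)
  then obtain r' where r': "r' \<le> d" "\<And>x y. x \<in> X \<Longrightarrow> y \<in> X \<Longrightarrow> rel x y = r \<longleftrightarrow> rel y x = r'"
    using rel_transpose by meson
  define c where "c l = P l r - P l r'" for l
  define M where "M u v = adj rel r u v - adj rel r' u v" for u v
  have M: "M u v = (\<Sum>l\<le>d. c l * E l u v)" if "u \<in> X" "v \<in> X" for u v
    using that r r' by (simp add: M_def c_def adj_eq algebra_simps sum_subtractf)
  have anti: "M v u = - M u v" if "u \<in> X" "v \<in> X" for u v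
    using that r' by (simp add: M_def adj_def)
  have "(\<Sum>z\<in>X. M x z * M z x) = (\<Sum>z\<in>X. \<Sum>l\<le>d. c l * (M x z * E l z x))"
    using assms by (intro sum.cong refl) (subst (2) M, auto simp: sum_distrib_left algebra_simps)
  also have "\<dots> = (\<Sum>l\<le>d. c l * (\<Sum>z\<in>X. M x z * E l z x))"
    by (subst sum.swap) (simp add: sum_distrib_left)
  also have "\<dots> = (\<Sum>l\<le>d. c l * (c l * E l x x))"
    using assms M by (intro sum.cong) (auto simp: comb_mult_E[where c = c])
  also have "\<dots> \<ge> 0"
  proof (rule sum_nonneg)
    fix l assume "l \<in> {..d}"
    \<comment> \<open>By duality |X| \<open>E l x x\<close> is \<open>P 0 l\<close>, which is a
      valency.\<close>
    then have "E l x x \<ge> 0"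
      using assms E_eq[of l x x] valency[of l x] rel_0 card_pos
      by (metis atMost_iff divide_nonneg_pos of_nat_0_le_iff)
    then show "c l * (c l * E l x x) \<ge> 0"
      by (simp add: mult.assoc[symmetric])
  qed
  finally have "0 \<le> (\<Sum>z\<in>X. M x z * M z x)" .
  also have "(\<Sum>z\<in>X. M x z * M z x) = (\<Sum>z\<in>X. - (M x z * M x z))"
    using anti[OF assms(1)] by (intro sum.cong refl) simp
  finally have "(\<Sum>z\<in>X. M x z * M x z) \<le> 0"
    by (simp add: sum_negf)
  moreover have "(\<Sum>z\<in>X. M x z * M x z) \<ge> M x y * M x y"
    using assms by (intro member_le_sum) auto
  ultimately have "M x y = 0"
    by (smt (verit) mult_eq_0_iff zero_le_mult_iff)
  then have "rel x y = r'" using r_def by (simp add: M_def adj_def split: if_splits)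
  then show ?thesis using r' assms r_def by metis
qed


section \<open>The first eigenspace\<close>

definition \<theta> :: "nat \<Rightarrow> real" where "\<theta> i = P i 1"
definition nb :: "'a \<Rightarrow> 'a set" where "nb x = {y\<in>X. rel x y = 1}"
definition K :: nat where "K = card (nb u0)"
definition S :: "'a set" where "S = nb u0"

text \<open>The support of \<open>f\<^sub>z\<close> for \<open>z \<in> S\<close>, written without truncated subtraction.\<close>
definition Y :: "'a \<Rightarrow> 'a set" where "Y z = {x\<in>X. Suc (rel z x) = rel u0 x}"

text \<open>Unlike \<open>Lspace\<close>, this ignores values outside \<open>X\<close>, so functions
  shifted by a constant qualify.\<close>

definition L1 :: "('a \<Rightarrow> real) \<Rightarrow> bool" where
  "L1 F \<longleftrightarrow> (\<exists>v. \<forall>x\<in>X. F x = (\<Sum>y\<in>X. E 1 x y * v y))"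

lemma d_pos: "1 \<le> d" "0 < d" using diam by auto

lemma finite_nb [simp]: "finite (nb x)" "finite S" "finite (Y z)"
  by (auto simp: nb_def S_def Y_def)

lemma Y_subset: "Y z \<subseteq> X"
  by (auto simp: Y_def)

lemma S_in_X: "z \<in> S \<Longrightarrow> z \<in> X" by (simp add: S_def nb_def)

lemma rel_S: "z \<in> S \<Longrightarrow> rel u0 z = 1" "z \<in> S \<Longrightarrow> rel z u0 = 1"
  using rel_sym[of u0 z] base by (simp_all add: S_def nb_def)

lemma \<theta>_0: "\<theta> 0 = K"
  using valency[of 1 u0] d_pos base by (simp add: \<theta>_def K_def nb_def)

lemma card_nb: "x \<in> X \<Longrightarrow> card (nb x) = K"
  using valency[of 1 x] \<theta>_0 d_pos by (simp add: \<theta>_def nb_def)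

lemma E_1: "x \<in> X \<Longrightarrow> y \<in> X \<Longrightarrow> E 1 x y = \<theta> (rel x y) / real (card X)"
  using E_eq d_pos by (simp add: \<theta>_def)

lemma u0_notin_Y: "u0 \<notin> Y z"
  using rel_0[OF base base] by (auto simp: Y_def)

lemma S_in_Y: "y \<in> S \<Longrightarrow> z \<in> S \<Longrightarrow> y \<in> Y z \<longleftrightarrow> y = z"
  using rel_0[of z y] by (auto simp: Y_def rel_S S_in_X)

lemma L1_diff:
  assumes "L1 F" "L1 G"
  shows "L1 (\<lambda>x. F x - G x)"
proof -
  obtain v w where "\<forall>x\<in>X. F x = (\<Sum>y\<in>X. E 1 x y * v y)" "\<forall>x\<in>X. G x = (\<Sum>y\<in>X. E 1 x y * w y)"
    using assms unfolding L1_def by blast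
  then show ?thesis
    unfolding L1_def by (intro exI[of _ "\<lambda>y. v y - w y"]) (simp add: right_diff_distrib sum_subtractf)
qed

text \<open>The function is column \<open>y\<close> of |X| \<open>E 1\<close>.\<close>

lemma L1_kernel:
  assumes "y \<in> X"
  shows "L1 (\<lambda>x. \<theta> (rel x y))"
  unfolding L1_def
proof (intro exI ballI)
  fix x assume "x \<in> X"
  have "(\<Sum>z\<in>X. E 1 x z * (if z = y then real (card X) else 0))
      = (\<Sum>z\<in>X. if z = y then E 1 x y * real (card X) else 0)"
    by (intro sum.cong) auto
  also have "\<dots> = \<theta> (rel x y)" using assms \<open>x \<in> X\<close> by (simp add: E_1)
  finally show "\<theta> (rel x y) = (\<Sum>z\<in>X. E 1 x z * (if z = y then real (card X) else 0))" ..
qed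

text \<open>A row that acts on the columns of \<open>E 1\<close> as a scalar acts so on their whole
  span. Taking rows of \<open>A_1\<close>, \<open>E 0\<close> and \<open>E 1\<close> gives the
  eigenvalue equation, the vanishing sum and the reproducing property.\<close>

lemma L1_mult:
  assumes "L1 F" "x \<in> X" and M: "\<And>y. y \<in> X \<Longrightarrow> (\<Sum>z\<in>X. M z * E 1 z y) = c * E 1 x y"
  shows "(\<Sum>z\<in>X. M z * F z) = c * F x"
proof -
  obtain v where v: "\<And>x. x \<in> X \<Longrightarrow> F x = (\<Sum>y\<in>X. E 1 x y * v y)"
    using assms(1) unfolding L1_def by blast
  have "(\<Sum>z\<in>X. M z * F z) = (\<Sum>z\<in>X. \<Sum>y\<in>X. M z * E 1 z y * v y)"
    using v by (intro sum.cong) (auto simp: sum_distrib_left mult.assoc)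
  also have "\<dots> = (\<Sum>y\<in>X. (\<Sum>z\<in>X. M z * E 1 z y) * v y)"
    by (subst sum.swap) (simp add: sum_distrib_right)
  also have "\<dots> = (\<Sum>y\<in>X. c * (E 1 x y * v y))"
    using M by (intro sum.cong) auto
  also have "\<dots> = c * F x" using v assms by (simp add: sum_distrib_left)
  finally show ?thesis .
qed

lemma L1_eigen:
  assumes "L1 F" "x \<in> X"
  shows "(\<Sum>y\<in>nb x. F y) = \<theta> 1 * F x"
proof -
  have "(\<Sum>z\<in>X. adj rel 1 x z * F z) = \<theta> 1 * F x"
    by (rule L1_mult[OF assms]) (use assms adj_mult_E d_pos in \<open>auto simp: \<theta>_def\<close>)
  moreover have "(\<Sum>z\<in>X. adj rel 1 x z * F z) = (\<Sum>z\<in>X. if rel x z = 1 then F z else 0)"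
    by (intro sum.cong) (auto simp: adj_def)
  ultimately show ?thesis by (simp add: sum.inter_filter nb_def)
qed

lemma L1_sum:
  assumes "L1 F"
  shows "(\<Sum>x\<in>X. F x) = 0"
proof -
  have "(\<Sum>z\<in>X. E 0 u0 z * F z) = 0 * F u0"
    by (rule L1_mult[OF assms base]) (use d_pos base in \<open>auto simp: E_mult\<close>)
  then have "(\<Sum>z\<in>X. F z) / real (card X) = 0"
    using base by (simp add: E_0 sum_divide_distrib)
  then show ?thesis by simp
qed

lemma L1_reproducing:
  assumes "L1 F" "x \<in> X"
  shows "(\<Sum>y\<in>X. \<theta> (rel y x) * F y) = real (card X) * F x"
proof -
  have "(\<Sum>z\<in>X. E 1 x z * F z) = 1 * F x"
    by (rule L1_mult[OF assms]) (use assms d_pos in \<open>auto simp: E_mult\<close>)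
  then have "(\<Sum>y\<in>X. \<theta> (rel x y) * F y) / real (card X) = F x"
    using assms by (simp add: E_1 sum_divide_distrib)
  moreover have "(\<Sum>y\<in>X. \<theta> (rel x y) * F y) = (\<Sum>y\<in>X. \<theta> (rel y x) * F y)"
    using assms rel_sym by (intro sum.cong) auto
  ultimately show ?thesis by (simp add: divide_eq_eq mult.commute)
qed

section \<open>Homogeneous functions as elements of the eigenspace\<close>

lemma fz_S: "z \<in> S \<Longrightarrow> x \<in> X \<Longrightarrow> fz X rel u0 z x = of_bool (x \<in> Y z)"
  using rel_sym[of x z] S_in_X[of z] base rel_0[of u0 x] by (auto simp: fz_def Y_def rel_S)

lemma fz_u0: "x \<in> X \<Longrightarrow> fz X rel u0 u0 x = 1"
  using rel_sym[OF base] rel_0[OF base base] by (simp add: fz_def)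

lemma hom_sum_eq:
  "subspace_sum (Hom X rel u0 0) (Hom X rel u0 1) =
     {f. \<exists>a c. f = (\<lambda>x. a * fz X rel u0 u0 x + (\<Sum>z\<in>S. c z * fz X rel u0 z x))}"
proof -
  have "{z\<in>X. rel u0 z = 0} = {u0}" using base rel_0 by auto
  then have "Hom X rel u0 0 = {f. \<exists>a. f = (\<lambda>x. a * fz X rel u0 u0 x)}"
    unfolding Hom_def by (auto intro: exI[of _ "\<lambda>_. _"])
  moreover have "Hom X rel u0 1 = {f. \<exists>c. f = (\<lambda>x. \<Sum>z\<in>S. c z * fz X rel u0 z x)}"
    unfolding Hom_def S_def nb_def ..
  ultimately show ?thesis unfolding subspace_sum_def by (auto; metis)
qed

lemma Y_decomp:
  assumes "z \<in> S"
  obtains \<alpha> where "L1 (\<lambda>x. of_bool (x \<in> Y z) - \<alpha>)"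
proof -
  have "fz X rel u0 z = (\<lambda>x. 0 * fz X rel u0 u0 x + (\<Sum>w\<in>S. of_bool (w = z) * fz X rel u0 w x))"
    using assms by (simp add: of_bool_def if_distrib[of "\<lambda>u. u * _"] cong: if_cong)
  then have "fz X rel u0 z \<in> subspace_sum (Lspace X E 0) (Lspace X E 1)"
    unfolding hom[symmetric] hom_sum_eq mem_Collect_eq
    by (intro exI[of _ 0] exI[of _ "\<lambda>w. of_bool (w = z)"])
  then obtain f g where fg: "f \<in> Lspace X E 0" "g \<in> Lspace X E 1" "fz X rel u0 z = (\<lambda>x. f x + g x)"
    unfolding subspace_sum_def by blast
  obtain v where v: "\<forall>x\<in>X. f x = (\<Sum>y\<in>X. E 0 x y * v y)"
    using fg(1) unfolding Lspace_def by blast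
  define \<alpha> where "\<alpha> = (\<Sum>y\<in>X. 1 / real (card X) * v y)"
  have "f x = \<alpha>" if "x \<in> X" for x using v that by (simp add: \<alpha>_def E_0)
  then have "\<forall>x\<in>X. of_bool (x \<in> Y z) - \<alpha> = g x"
    using fg(3) fz_S[OF assms] by (metis add_diff_cancel_left')
  then have "L1 (\<lambda>x. of_bool (x \<in> Y z) - \<alpha>)"
    using fg(2) unfolding L1_def Lspace_def by auto
  then show ?thesis using that by blast
qed

text \<open>At \<open>u0\<close> the eigenvalue equation involves a single neighbour in
  \<open>Y z\<close>, namely \<open>z\<close>, which fixes \<open>\<alpha>\<close>. Substituting
  this back at any \<open>x\<close> gives the count.\<close>

lemma Y_mean:
  assumes "z \<in> S" "L1 (\<lambda>x. of_bool (x \<in> Y z) - \<alpha>)"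
  shows "(K - \<theta> 1) * \<alpha> = 1"
    and "x \<in> X \<Longrightarrow> real (card (nb x \<inter> Y z)) = 1 + \<theta> 1 * of_bool (x \<in> Y z)"
proof -
  have *: "real (card (nb x \<inter> Y z)) - K * \<alpha> = \<theta> 1 * (of_bool (x \<in> Y z) - \<alpha>)" if "x \<in> X" for x
    using L1_eigen[OF assms(2) that] card_nb[OF that]
    by (simp add: sum_subtractf of_bool_def sum.If_cases)
  have "nb u0 \<inter> Y z = {z}" using assms(1) S_in_Y[of _ z] by (auto simp: S_def)
  then show "(K - \<theta> 1) * \<alpha> = 1"
    using *[OF base] u0_notin_Y by (simp add: algebra_simps)
  then show "real (card (nb x \<inter> Y z)) = 1 + \<theta> 1 * of_bool (x \<in> Y z)" if "x \<in> X"
    using *[OF that] by (simp add: algebra_simps)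
qed

lemma card_nb_Y: "z \<in> S \<Longrightarrow> x \<in> X \<Longrightarrow> real (card (nb x \<inter> Y z)) = 1 + \<theta> 1 * of_bool (x \<in> Y z)"
  using Y_mean(2) Y_decomp by meson

lemma card_nb_Y_outside: "z \<in> S \<Longrightarrow> x \<in> X \<Longrightarrow> x \<notin> Y z \<Longrightarrow> card (nb x \<inter> Y z) = 1"
  using card_nb_Y[of z x] by simp

section \<open>Local parameters at \<open>u0\<close>, the basis of \<open>L1\<close> and the first
  eigenvalues\<close>

definition a :: nat where "a = card {w\<in>X. rel (SOME z. z \<in> S) w = 1 \<and> rel w u0 = 1}"

text \<open>\<open>a\<close> and \<open>b\<close> are the intersection numbers a_1 and b_1; in
  H(d,q) the former equals q - 2. The truncated subtraction in \<open>b\<close> is exact by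
  \<open>K_ge\<close>.\<close>

definition q :: nat where "q = a + 2"

definition b :: nat where "b = K - 1 - a"

lemma rel_2_exists:
  obtains x y z where "x \<in> X" "y \<in> X" "z \<in> X" "rel x y = 2" "rel x z = 1" "rel z y = 1"
proof -
  obtain x y where xy: "x \<in> X" "y \<in> X" "rel x y = 2" using rel_occurs[of 2] diam by auto
  then obtain z where z: "z \<in> X" "rel x z = 1" "rel z y = 1"
    using walk_rel[of x y] by (auto simp: numeral_2_eq_2)
  then show ?thesis using that xy by auto
qed

lemma S_nonempty: "\<exists>z. z \<in> S"
proof -
  obtain x z where "x \<in> X" "z \<in> X" "rel x z = 1" using rel_2_exists by metis
  then have "z \<in> nb x" "x \<in> X" by (simp_all add: nb_def)
  then have "K > 0" using card_nb[of x] card_gt_0_iff[of "nb x"] by auto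
  then show ?thesis unfolding K_def S_def by (metis card.empty ex_in_conv less_irrefl)
qed

lemma card_common:
  assumes "x \<in> X" "y \<in> X" "rel x y = 1"
  shows "card (nb x \<inter> nb y) = a"
proof -
  obtain p where p: "\<And>x y. x \<in> X \<Longrightarrow> y \<in> X \<Longrightarrow> rel x y = 1 \<Longrightarrow>
      card {z\<in>X. rel x z = 1 \<and> rel z y = 1} = p"
    using intersection_number[of 1 1 1] d_pos by blast
  have "(SOME z. z \<in> S) \<in> S" using S_nonempty by (rule someI_ex)
  then have "a = p" unfolding a_def using p base rel_S S_in_X by simp
  moreover have "nb x \<inter> nb y = {z\<in>X. rel x z = 1 \<and> rel z y = 1}"
    using assms rel_sym by (auto simp: nb_def)
  ultimately show ?thesis using p assms by simp
qed

lemma nb_split: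
  assumes "z \<in> S"
  shows "nb z = {u0} \<union> (S \<inter> nb z) \<union> (nb z \<inter> Y z)" and "u0 \<notin> S \<inter> nb z"
    and "({u0} \<union> (S \<inter> nb z)) \<inter> (nb z \<inter> Y z) = {}"
    and "nb z \<inter> Y z = {w \<in> nb z. rel u0 w = 2}"
proof -
  have z: "z \<in> X" "rel z u0 = 1" "rel u0 z = 1" using assms by (auto simp: rel_S S_in_X)
  show 4: "nb z \<inter> Y z = {w \<in> nb z. rel u0 w = 2}" by (auto simp: nb_def Y_def)
  have "rel u0 w \<le> 2" if "w \<in> nb z" for w
    using rel_step[of u0 z w] z base that by (simp add: nb_def)
  then show "nb z = {u0} \<union> (S \<inter> nb z) \<union> (nb z \<inter> Y z)"
    unfolding 4 using z base rel_0[OF base] by (fastforce simp: nb_def S_def le_Suc_eq numeral_2_eq_2)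
  show "u0 \<notin> S \<inter> nb z" using rel_S rel_0 base by force
  show "({u0} \<union> (S \<inter> nb z)) \<inter> (nb z \<inter> Y z) = {}"
    unfolding 4 using rel_S rel_0[OF base base] by force
qed

lemma card_nb_Y_self: "z \<in> S \<Longrightarrow> card (nb z \<inter> Y z) = b"
  and K_ge: "K \<ge> 1 + a"
proof -
  have *: "K = 1 + a + card (nb z \<inter> Y z)" if "z \<in> S" for z
  proof -
    have "card (nb z) = card ({u0} \<union> (S \<inter> nb z)) + card (nb z \<inter> Y z)"
      using card_Un_disjoint[of "{u0} \<union> (S \<inter> nb z)" "nb z \<inter> Y z"] nb_split[OF that] by simp
    also have "card ({u0} \<union> (S \<inter> nb z)) = 1 + a"
      using card_common[of u0 z] nb_split(2)[OF that] that base by (simp add: S_in_X rel_S S_def)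
    finally show ?thesis using card_nb that S_in_X by simp
  qed
  show "z \<in> S \<Longrightarrow> card (nb z \<inter> Y z) = b" using * unfolding b_def by fastforce
  show "K \<ge> 1 + a" using * S_nonempty by fastforce
qed

text \<open>The neighbours of \<open>z\<close> in \<open>Y z\<close> are counted twice: as b_1 from
  the local structure, and as \<open>1 + \<theta> 1\<close> from the eigenvector.\<close>

lemma \<theta>_1: "\<theta> 1 = real K - real q"
proof -
  obtain z where z: "z \<in> S" using S_nonempty by blast
  have "real b = 1 + \<theta> 1" using card_nb_Y[of z z] S_in_Y[of z z] z card_nb_Y_self S_in_X by simp
  then show ?thesis using K_ge by (simp add: b_def q_def of_nat_diff)
qed

lemma q_pos: "real q > 0" "q \<ge> 2" by (simp_all add: q_def)

lemma card_nb_Y_inside: "z \<in> S \<Longrightarrow> x \<in> X \<Longrightarrow> x \<in> Y z \<Longrightarrow> card (nb x \<inter> Y z) = b"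
  using card_nb_Y[of z x] \<theta>_1 K_ge by (simp add: b_def q_def)

lemma L1_Y:
  assumes "z \<in> S"
  shows "L1 (\<lambda>x. of_bool (x \<in> Y z) - 1 / real q)"
proof -
  obtain \<alpha> where \<alpha>: "L1 (\<lambda>x. of_bool (x \<in> Y z) - \<alpha>)" using Y_decomp assms by blast
  have "real q * \<alpha> = 1" using Y_mean(1)[OF assms \<alpha>] \<theta>_1 by simp
  then have "\<alpha> = 1 / real q" using q_pos by (simp add: field_simps)
  then show ?thesis using \<alpha> by simp
qed

lemma card_Y: "z \<in> S \<Longrightarrow> real (card (Y z)) = real (card X) / real q"
  using L1_sum[OF L1_Y, of z] Y_subset[of z]
  by (simp add: sum_subtractf of_bool_def sum.If_cases Int_absorb1)

text \<open>Evaluating at \<open>u0\<close> and on \<open>S\<close> shows that the centred indicators of the \<open>Y z\<close> form a basis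
  of the eigenspace, dual to the functionals \<open>F \<mapsto> F z - F u0\<close>.\<close>
lemma L1_expansion:
  assumes "L1 F" "x \<in> X"
  shows "F x = (\<Sum>z\<in>S. (F z - F u0) * (of_bool (x \<in> Y z) - 1 / real q))"
proof -
  define G where "G x = (if x \<in> X then F x else 0)" for x
  have "G \<in> Lspace X E 1" using assms by (auto simp: G_def Lspace_def L1_def)
  moreover have "(\<lambda>_. 0) \<in> Lspace X E 0" by (auto simp: Lspace_def intro!: exI[of _ "\<lambda>_. 0"])
  ultimately have "(\<lambda>x. 0 + G x) \<in> subspace_sum (Lspace X E 0) (Lspace X E 1)"
    unfolding subspace_sum_def mem_Collect_eq by (intro exI[of _ "\<lambda>_. 0"] exI[of _ G] conjI refl)
  then obtain e c where ec: "\<And>x. 0 + G x = e * fz X rel u0 u0 x + (\<Sum>z\<in>S. c z * fz X rel u0 z x)"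
    unfolding hom[symmetric] hom_sum_eq mem_Collect_eq by metis
  have F: "F x = e + (\<Sum>z\<in>S. c z * of_bool (x \<in> Y z))" if "x \<in> X" for x
    using ec[of x] that by (simp add: G_def fz_S fz_u0 cong: sum.cong)
  have e: "F u0 = e" using F[OF base] u0_notin_Y by simp
  have c: "F z - F u0 = c z" if "z \<in> S" for z
  proof -
    have "F z = e + (\<Sum>w\<in>S. if w = z then c w else 0)"
      unfolding F[OF S_in_X[OF that]] using S_in_Y that by (intro arg_cong[of _ _ "(+) e"] sum.cong) auto
    then show ?thesis using e that by simp
  qed
  \<comment> \<open>The sum of \<open>F\<close> vanishes, which expresses the constant
    \<open>e\<close> through the coefficients \<open>c\<close>.\<close>
  have "0 = (\<Sum>x\<in>X. e + (\<Sum>z\<in>S. c z * of_bool (x \<in> Y z)))"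
    using L1_sum[OF assms(1)] F by simp
  also have "\<dots> = real (card X) * e + (\<Sum>z\<in>S. \<Sum>x\<in>X. c z * of_bool (x \<in> Y z))"
    unfolding sum.distrib sum.swap[of _ S] by simp
  also have "(\<Sum>z\<in>S. \<Sum>x\<in>X. c z * of_bool (x \<in> Y z)) = (\<Sum>z\<in>S. c z * (real (card X) / real q))"
    using card_Y Y_subset
    by (intro sum.cong refl) (simp add: of_bool_def sum.If_cases Int_absorb1 flip: sum_distrib_left)
  also have "\<dots> = real (card X) * (\<Sum>z\<in>S. c z / real q)"
    by (simp add: sum_distrib_left mult.commute)
  finally have "e + (\<Sum>z\<in>S. c z / real q) = 0"
    using card_pos by (simp add: distrib_left[symmetric] del: of_nat_0_less_iff)
  then have "F x = (\<Sum>z\<in>S. c z * (of_bool (x \<in> Y z) - 1 / real q))"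
    using F[OF assms(2)] by (simp add: right_diff_distrib sum_subtractf)
  then show ?thesis using c by simp
qed


text \<open>There is no kite with \<open>u0\<close> at a tip of degree two: \<open>y\<close> lies outside \<open>Y z\<close>, so it has only one
  neighbour there, namely \<open>z\<close>.\<close>
lemma no_kite:
  assumes "y \<in> S" "z \<in> S" "rel z y = 1" "w \<in> X" "rel u0 w = 2" "rel z w = 1"
  shows "rel y w \<noteq> 1"
proof
  assume "rel y w = 1"
  have yz: "y \<in> X" "z \<in> X" "rel y z = 1" using assms S_in_X rel_sym by auto
  have "y \<notin> Y z" using assms yz by (simp add: Y_def rel_S)
  then have "card (nb y \<inter> Y z) = 1" using card_nb_Y_outside assms yz by blast
  moreover have "z \<in> nb y \<inter> Y z" using yz S_in_Y assms by (simp add: nb_def)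
  moreover have "w \<in> nb y \<inter> Y z" using \<open>rel y w = 1\<close> assms by (simp add: nb_def Y_def)
  ultimately have "w = z" by (metis card_1_singletonE singletonD)
  then show False using assms rel_S by simp
qed

text \<open>\<open>y\<close> has exactly one neighbour in \<open>Y z\<close>; the distance bound
  puts it at distance 2 from \<open>u0\<close>, hence adjacent to \<open>z\<close>.\<close>

lemma unique_square:
  assumes "y \<in> S" "z \<in> S" "y \<noteq> z" "rel z y \<noteq> 1"
  shows "card {w \<in> nb z \<inter> Y z. w \<in> nb y} = 1"
proof -
  have yz: "y \<in> X" "z \<in> X" using assms S_in_X by auto
  have "y \<notin> Y z" using assms S_in_Y by blast
  then have "card (nb y \<inter> Y z) = 1" using card_nb_Y_outside assms yz by blast
  moreover have "nb y \<inter> Y z = {w \<in> nb z \<inter> Y z. w \<in> nb y}"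
  proof -
    have "w \<in> nb z" if w: "w \<in> nb y" "w \<in> Y z" for w
    proof -
      have wX: "w \<in> X" "rel y w = 1" "Suc (rel z w) = rel u0 w" using w by (auto simp: nb_def Y_def)
      have "rel u0 w \<le> 2" using rel_step[OF base yz(1) wX(1,2)] rel_S assms by simp
      moreover have "rel z w \<noteq> 0"
        using wX assms yz rel_0[of z w] rel_sym[of y z] by auto
      ultimately show ?thesis using wX by (simp add: nb_def)
    qed
    then show ?thesis by auto
  qed
  ultimately show ?thesis by simp
qed

text \<open>A path between vertices at distance 2 makes an intersection number positive, and this
  number is the same at every edge.\<close>

lemma b_pos: "b > 0"
proof -
  obtain x y z where xyz: "x \<in> X" "y \<in> X" "z \<in> X" "rel x y = 2" "rel x z = 1" "rel z y = 1"
    using rel_2_exists .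
  obtain p where p: "\<And>x y. x \<in> X \<Longrightarrow> y \<in> X \<Longrightarrow> rel x y = 1 \<Longrightarrow>
      card {w\<in>X. rel x w = 1 \<and> rel w y = 2} = p"
    using intersection_number[of 1 2 1] d_pos diam by blast
  have "y \<in> {w\<in>X. rel z w = 1 \<and> rel w x = 2}" using xyz rel_sym by auto
  then have "p > 0" using p[of z x] xyz rel_sym[of x z] card_gt_0_iff[of "{w\<in>X. rel z w = 1 \<and> rel w x = 2}"] by auto
  obtain s where s: "s \<in> S" using S_nonempty by blast
  have "{w\<in>X. rel s w = 1 \<and> rel w u0 = 2} = nb s \<inter> Y s"
    using nb_split(4)[OF s] rel_sym[OF base] by (auto simp: nb_def)
  then show ?thesis using p[of s u0] s base \<open>p > 0\<close> card_nb_Y_self by (simp add: S_in_X rel_S)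
qed

lemma card_nonadjacent:
  assumes "z \<in> S"
  shows "card {y \<in> S. y \<noteq> z \<and> rel z y \<noteq> 1} = b"
proof -
  have z: "z \<in> X" "rel u0 z = 1" using assms S_in_X rel_S by auto
  have "{y \<in> S. y \<noteq> z \<and> rel z y \<noteq> 1} = S - insert z (S \<inter> nb z)"
    using S_in_X by (auto simp: nb_def)
  moreover have "card (insert z (S \<inter> nb z)) = Suc a"
    using card_common[OF base z] rel_0[OF z(1) z(1)] by (simp add: S_def nb_def)
  moreover have "card S = K" by (simp add: S_def K_def)
  ultimately show ?thesis using assms by (simp add: card_Diff_subset b_def)
qed

text \<open>Double counting of the edges between \<open>nb z \<inter> Y z\<close> and the non-neighbours of \<open>z\<close> in \<open>S\<close>.\<close>
lemma card_common_2:
  assumes "x \<in> X" "y \<in> X" "rel x y = 2"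
  shows "card (nb x \<inter> nb y) = 2"
proof -
  obtain c where c': "\<And>x y. x \<in> X \<Longrightarrow> y \<in> X \<Longrightarrow> rel x y = 2 \<Longrightarrow>
      card {z\<in>X. rel x z = 1 \<and> rel z y = 1} = c"
    using intersection_number[of 1 1 2] d_pos diam by blast
  have c: "card (nb x \<inter> nb y) = c" if "x \<in> X" "y \<in> X" "rel x y = 2" for x y
  proof -
    have "nb x \<inter> nb y = {z\<in>X. rel x z = 1 \<and> rel z y = 1}"
      using that rel_sym by (auto simp: nb_def)
    then show ?thesis using c' that by simp
  qed
  obtain z where z: "z \<in> S" using S_nonempty by blast
  then have zX: "z \<in> X" by (rule S_in_X)
  define N where "N = {y \<in> S. y \<noteq> z \<and> rel z y \<noteq> 1}"
  have "(\<Sum>w\<in>nb z \<inter> Y z. card {y \<in> N. w \<in> nb y}) = (\<Sum>y\<in>N. card {w \<in> nb z \<inter> Y z. w \<in> nb y})"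
    by (rule sum_card_swap) (simp_all add: N_def)
  also have "\<dots> = b"
    using unique_square z card_nonadjacent[OF z] by (simp add: N_def)
  also have "(\<Sum>w\<in>nb z \<inter> Y z. card {y \<in> N. w \<in> nb y}) = (\<Sum>w\<in>nb z \<inter> Y z. c - 1)"
  proof (rule sum.cong[OF refl])
    fix w assume "w \<in> nb z \<inter> Y z"
    then have w: "w \<in> X" "rel z w = 1" "rel u0 w = 2" using nb_split(4)[OF z] by (auto simp: nb_def)
    \<comment> \<open>Of the \<open>c\<close> common neighbours of \<open>u0\<close> and
      \<open>w\<close> one is \<open>z\<close>; by \<open>no_kite\<close> the others are not
      adjacent to \<open>z\<close>.\<close>
    have "{y \<in> N. w \<in> nb y} = nb u0 \<inter> nb w - {z}"
      using no_kite[OF _ z _ w(1,3,2)] w rel_sym[of w] by (auto simp: N_def nb_def S_def)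
    moreover have "z \<in> nb u0 \<inter> nb w" using z zX w rel_sym by (simp add: S_def nb_def)
    ultimately show "card {y \<in> N. w \<in> nb y} = c - 1" using c[OF base w(1,3)] by simp
  qed
  finally have "b * (c - 1) = b" using card_nb_Y_self[OF z] by simp
  then have "c = 2" using b_pos by simp
  then show ?thesis using c assms by simp
qed

lemma S_dist:
  assumes "y \<in> S" "z \<in> S" "y \<noteq> z" "rel z y \<noteq> 1"
  shows "rel z y = 2"
proof -
  have "rel z y \<le> 2" using rel_step[of z u0 y] assms base S_in_X rel_S by (simp add: numeral_2_eq_2 One_nat_def)
  then show ?thesis using assms rel_0[of z y] S_in_X by fastforce
qed

text \<open>Otherwise \<open>y\<close> and \<open>z\<close> are at distance 2 with three common
  neighbours: \<open>u0\<close>, \<open>x\<close> and the fourth vertex of their square.\<close>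

lemma S_adj_trans:
  assumes "x \<in> S" "y \<in> S" "z \<in> S" "rel x y = 1" "rel x z = 1" "y \<noteq> z"
  shows "rel y z = 1"
proof (rule ccontr)
  assume ne: "rel y z \<noteq> 1"
  have X: "x \<in> X" "y \<in> X" "z \<in> X" using assms S_in_X by auto
  have "rel y z = 2" using S_dist[of z y] ne assms by auto
  then have 2: "card (nb y \<inter> nb z) = 2" using card_common_2 X by simp
  obtain w where w: "w \<in> nb z \<inter> Y z" "w \<in> nb y"
    using unique_square[of y z] assms ne rel_sym[OF X(2,3)]
    by (metis (no_types, lifting) card.empty equals0I mem_Collect_eq zero_neq_one)
  have "rel u0 w = 2" using w nb_split(4)[OF assms(3)] by auto
  then have "u0 \<noteq> x" "u0 \<noteq> w" "x \<noteq> w" using rel_S[OF assms(1)] rel_0[OF base base] by auto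
  then have "card {u0, x, w} = 3" by simp
  moreover have "{u0, x, w} \<subseteq> nb y \<inter> nb z"
    using w assms X base rel_S rel_sym[OF X(1)] by (auto simp: nb_def)
  ultimately show False using 2 card_mono[of "nb y \<inter> nb z" "{u0, x, w}"] by simp
qed

text \<open>The kernel function at \<open>u0\<close> is an eigenvector; its equation at a neighbour
  \<open>z\<close> is the three-term recurrence, solved for \<open>\<theta> 2\<close> since
  \<open>b\<close> is positive.\<close>

lemma \<theta>_2: "\<theta> 2 = real K - 2 * real q"
proof -
  obtain z where z: "z \<in> S" using S_nonempty by blast
  then have zX: "z \<in> X" by (rule S_in_X)
  have "(\<Sum>w\<in>nb z. \<theta> (rel w u0)) = \<theta> 1 * \<theta> 1"
    using L1_eigen[OF L1_kernel[OF base] zX] rel_S[OF z] by simp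
  also have "(\<Sum>w\<in>nb z. \<theta> (rel w u0))
      = \<theta> (rel u0 u0) + (\<Sum>w\<in>S \<inter> nb z. \<theta> (rel w u0)) + (\<Sum>w\<in>nb z \<inter> Y z. \<theta> (rel w u0))"
    by (subst nb_split(1)[OF z], subst sum.union_disjoint)
       (use nb_split(2,3)[OF z] in \<open>auto simp: sum.insert_if\<close>)
  also have "(\<Sum>w\<in>S \<inter> nb z. \<theta> (rel w u0)) = real a * \<theta> 1"
    using card_common[OF base zX] rel_S z by (simp add: S_def)
  also have "(\<Sum>w\<in>nb z \<inter> Y z. \<theta> (rel w u0)) = (\<Sum>w\<in>nb z \<inter> Y z. \<theta> 2)"
    using nb_split(4)[OF z] rel_sym[OF base] by (intro sum.cong refl arg_cong[of _ _ \<theta>]) (auto simp: nb_def)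
  also have "\<theta> (rel u0 u0) = K" using rel_0[OF base base] \<theta>_0 by simp
  finally have eq: "real K + real a * \<theta> 1 + real b * \<theta> 2 = \<theta> 1 * \<theta> 1"
    using card_nb_Y_self[OF z] by simp
  have K: "real K = real b + real a + 1" using K_ge by (simp add: b_def)
  have \<theta>1: "\<theta> 1 = real b - 1" using \<theta>_1 K by (simp add: q_def)
  have "real b * \<theta> 2 = real b * (real b - real a - 3)"
    using eq unfolding \<theta>1 K by (simp add: algebra_simps)
  then have "\<theta> 2 = real b - real a - 3" using b_pos by simp
  then show ?thesis using K by (simp add: q_def)
qed

section \<open>Cliques in \<open>S\<close> and the Gram matrix\<close>

definition Cl :: "'a \<Rightarrow> 'a set" where
  "Cl y = {z \<in> S. z = y \<or> rel y z = 1}"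

lemma Cl_subset: "Cl y \<subseteq> S" "finite (Cl y)"
  by (auto simp: Cl_def)

lemma Cl_self: "y \<in> S \<Longrightarrow> y \<in> Cl y" by (simp add: Cl_def)

lemma Cl_eq:
  assumes "y \<in> S" "z \<in> Cl y"
  shows "Cl z = Cl y"
proof (cases "z = y")
  case False
  then have z: "z \<in> S" "rel y z = 1" "rel z y = 1" using assms S_in_X rel_sym by (auto simp: Cl_def)
  show ?thesis
  proof safe
    fix x assume x: "x \<in> Cl z"
    then show "x \<in> Cl y" using S_adj_trans[of z y x] z assms by (auto simp: Cl_def)
  next
    fix x assume x: "x \<in> Cl y"
    then show "x \<in> Cl z" using S_adj_trans[of y z x] z assms by (auto simp: Cl_def)
  qed
qed simp

lemma card_Cl:
  assumes "z \<in> S"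
  shows "card (Cl z) = a + 1"
proof -
  have z: "z \<in> X" "rel u0 z = 1" using assms S_in_X rel_S by auto
  have "Cl z = insert z (nb u0 \<inter> nb z)" using assms by (auto simp: Cl_def nb_def S_def)
  then show ?thesis
    using card_common[OF base z] rel_0[OF z(1) z(1)] by (simp add: nb_def)
qed

text \<open>These are the coefficients of a kernel difference in the basis of \<open>L1\<close>. As
  \<open>\<theta> 0\<close>, \<open>\<theta> 1\<close>, \<open>\<theta> 2\<close> fall in steps of
  \<open>q\<close>, the value is \<open>2q\<close>, \<open>q\<close> or 0.\<close>

lemma \<theta>_S_diff:
  assumes "y \<in> S" "z \<in> S"
  shows "\<theta> (rel z y) - 2 * \<theta> 1 + \<theta> 0 = real q * (of_bool (z = y) + of_bool (z \<in> Cl y))"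
proof -
  have X: "y \<in> X" "z \<in> X" using assms S_in_X by auto
  consider "z = y" | "z \<noteq> y" "rel z y = 1" | "z \<noteq> y" "rel z y \<noteq> 1" by blast
  then show ?thesis
  proof cases
    case 1
    then show ?thesis using rel_0[OF X(1) X(1)] assms by (simp add: Cl_def \<theta>_0 \<theta>_1)
  next
    case 2
    then show ?thesis using rel_sym[OF X] assms by (simp add: Cl_def \<theta>_0 \<theta>_1)
  next
    case 3
    then have "rel z y = 2" using S_dist[of y z] assms by auto
    then show ?thesis using 3 rel_sym[OF X] assms by (simp add: Cl_def \<theta>_0 \<theta>_1 \<theta>_2)
  qed
qed

text \<open>Expansion with the coefficients from \<open>\<theta>_S_diff\<close>. Counting
  \<open>y\<close> twice, there are \<open>a + 2 = q\<close> terms, whose shifts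
  \<open>1 / q\<close> add up to the final 1.\<close>

lemma kernel_diff:
  assumes "y \<in> S" "x \<in> X"
  shows "\<theta> (rel x y) - \<theta> (rel x u0) =
    real q * (of_bool (x \<in> Y y) + (\<Sum>z\<in>Cl y. of_bool (x \<in> Y z)) - 1)"
proof -
  define F where "F x = \<theta> (rel x y) - \<theta> (rel x u0)" for x
  let ?g = "\<lambda>z. of_bool (x \<in> Y z) - 1 / real q"
  have "L1 F" unfolding F_def using assms base S_in_X by (intro L1_diff L1_kernel)
  then have "F x = (\<Sum>z\<in>S. (F z - F u0) * ?g z)"
    using L1_expansion assms by blast
  also have "\<dots> = (\<Sum>z\<in>S. real q * (of_bool (z = y) * ?g z + of_bool (z \<in> Cl y) * ?g z))"
  proof (rule sum.cong[OF refl])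
    fix z assume z: "z \<in> S"
    have "F z - F u0 = real q * (of_bool (z = y) + of_bool (z \<in> Cl y))"
      using \<theta>_S_diff[OF assms(1) z] rel_S[OF z] rel_S[OF assms(1)] rel_0[OF base base]
      by (simp add: F_def)
    then show "(F z - F u0) * ?g z = real q * (of_bool (z = y) * ?g z + of_bool (z \<in> Cl y) * ?g z)"
      by (simp only: distrib_right mult.assoc)
  qed
  also have "\<dots> = real q * ((\<Sum>z\<in>S. of_bool (z = y) * ?g z) + (\<Sum>z\<in>S. of_bool (z \<in> Cl y) * ?g z))"
    by (simp only: sum.distrib flip: sum_distrib_left)
  also have "(\<Sum>z\<in>S. of_bool (z = y) * ?g z) = (\<Sum>z\<in>S. if z = y then ?g z else 0)"
    by (intro sum.cong) auto
  also have "\<dots> = ?g y" using assms by simp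
  also have "(\<Sum>z\<in>S. of_bool (z \<in> Cl y) * ?g z) = (\<Sum>z\<in>S. if z \<in> Cl y then ?g z else 0)"
    by (intro sum.cong) auto
  also have "\<dots> = (\<Sum>z\<in>Cl y. ?g z)"
    using Cl_subset by (simp add: sum.If_cases Int_absorb1)
  also have "\<dots> = (\<Sum>z\<in>Cl y. of_bool (x \<in> Y z)) - (real a + 1) / real q"
    using card_Cl[OF assms(1)] by (simp add: sum_subtractf)
  also have "(real a + 1) / real q = 1 - 1 / real q" by (simp add: q_def field_simps)
  finally show ?thesis by (simp add: F_def)
qed

text \<open>The Gram matrix of the centred indicators is the inverse of that of the kernel functions
  at \<open>S\<close>, which is known from \<open>\<theta> 0\<close>, \<open>\<theta> 1\<close> and \<open>\<theta> 2\<close>.\<close>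
lemma Y_disjoint:
  assumes "y \<in> S" "z \<in> Cl y" "z \<noteq> y"
  shows "Y y \<inter> Y z = {}"
proof -
  have zS: "z \<in> S" using assms Cl_subset by blast
  define n where "n = real (card X)"
  define G where "G x = of_bool (x \<in> Y z) - 1 / real q" for x
  have L: "L1 G" unfolding G_def using zS by (rule L1_Y)
  define M where "M w = (\<Sum>x\<in>X. of_bool (x \<in> Y w) * G x)" for w
  have G_S: "G w - G u0 = of_bool (w = z)" if "w \<in> S" for w
    using u0_notin_Y S_in_Y[OF that zS] by (simp add: G_def)
  \<comment> \<open>The reproducing property evaluates the product of \<open>G\<close> with a kernel
    difference, and \<open>kernel_diff\<close> rewrites it: a linear system for \<open>M\<close> on
    the clique.\<close>
  have M: "M w + sum M (Cl y) = n / real q * of_bool (w = z)" if w: "w \<in> Cl y" for w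
  proof -
    have wS: "w \<in> S" using w Cl_subset by blast
    have "n * of_bool (w = z) = n * G w - n * G u0"
      using G_S[OF wS] by (simp only: right_diff_distrib[symmetric])
    also have "\<dots> = (\<Sum>x\<in>X. (\<theta> (rel x w) - \<theta> (rel x u0)) * G x)"
      using L1_reproducing[OF L base] L1_reproducing[OF L S_in_X[OF wS]]
      by (simp add: n_def left_diff_distrib sum_subtractf)
    also have "\<dots> = (\<Sum>x\<in>X. real q * (of_bool (x \<in> Y w) * G x + (\<Sum>v\<in>Cl y. of_bool (x \<in> Y v) * G x) - G x))"
      using kernel_diff[OF wS] Cl_eq[OF assms(1) w]
      by (intro sum.cong) (auto simp: left_diff_distrib distrib_right sum_distrib_right mult.assoc)
    also have "\<dots> = real q * (M w + (\<Sum>x\<in>X. \<Sum>v\<in>Cl y. of_bool (x \<in> Y v) * G x) - sum G X)"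
      by (simp only: sum_distrib_left[symmetric] sum.distrib sum_subtractf M_def)
    also have "(\<Sum>x\<in>X. \<Sum>v\<in>Cl y. of_bool (x \<in> Y v) * G x) = sum M (Cl y)"
      unfolding M_def by (rule sum.swap)
    finally have "n * of_bool (w = z) = real q * (M w + sum M (Cl y))"
      using L1_sum[OF L] by simp
    then show ?thesis using q_pos by (simp add: field_simps)
  qed
  \<comment> \<open>Summing the system over the \<open>a + 1\<close> members of the clique
    determines \<open>sum M (Cl y)\<close>, and then \<open>M y\<close>.\<close>
  have "sum M (Cl y) = (\<Sum>w\<in>Cl y. n / real q * of_bool (w = z) - sum M (Cl y))"
    using M by (intro sum.cong) (auto simp: algebra_simps)
  also have "\<dots> = n / real q - (real a + 1) * sum M (Cl y)"
    using assms(2) card_Cl[OF assms(1)] Cl_subset(2)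
    by (simp add: sum_subtractf of_bool_def if_distrib[of "\<lambda>u. _ * u"] cong: if_cong)
  finally have "real q * sum M (Cl y) = n / real q" by (simp add: q_def algebra_simps)
  then have "real q * (real q * M y) = - n"
    using M[OF Cl_self[OF assms(1)]] assms(3) q_pos by (simp add: eq_neg_iff_add_eq_0[symmetric] field_simps)
  then have My: "M y = - n / (real q * real q)" using q_pos by (simp add: field_simps)
  \<comment> \<open>Expanding \<open>G\<close> instead, the term \<open>card (Y y) / q\<close>
    already accounts for all of \<open>M y\<close>, leaving nothing for the intersection.\<close>
  have "M y = (\<Sum>x\<in>X. of_bool (x \<in> Y y \<inter> Y z)) - (\<Sum>x\<in>X. of_bool (x \<in> Y y)) / real q"
    unfolding M_def G_def sum_divide_distrib sum_subtractf[symmetric] by (intro sum.cong) auto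
  also have "\<dots> = real (card (Y y \<inter> Y z)) - real (card (Y y)) / real q"
    using Y_subset by (simp add: of_bool_def sum.If_cases Int_absorb1 le_infI1 flip: Int_iff)
  finally have "real (card (Y y \<inter> Y z)) = 0"
    using My card_Y[OF assms(1)] by (simp add: n_def)
  then show ?thesis by simp
qed


section \<open>Digits and edges\<close>

text \<open>The left side is the difference of values at \<open>x\<close> and \<open>y\<close> of
  the kernel difference of \<open>x\<close> and \<open>y\<close>. Its expansion has coefficients
  given by \<open>kernel_diff\<close>, so a quadratic form in \<open>\<delta>\<close>
  results.\<close>

lemma edge_energy:
  assumes "x \<in> X" "y \<in> X"
  defines "\<delta> \<equiv> \<lambda>z. of_bool (x \<in> Y z) - of_bool (y \<in> Y z) :: real"
  shows "2 * (\<theta> 0 - \<theta> (rel x y)) = real q * (\<Sum>z\<in>S. (\<delta> z + sum \<delta> (Cl z)) * \<delta> z)"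
proof -
  define F where "F w = \<theta> (rel w x) - \<theta> (rel w y)" for w
  have "L1 F" unfolding F_def using assms by (intro L1_diff L1_kernel)
  have "2 * (\<theta> 0 - \<theta> (rel x y)) = F x - F y"
    using assms rel_sym rel_0[OF assms(1,1)] rel_0[OF assms(2,2)] by (simp add: F_def)
  also have "\<dots> = (\<Sum>z\<in>S. (F z - F u0) * \<delta> z)"
    unfolding L1_expansion[OF \<open>L1 F\<close> assms(1)] L1_expansion[OF \<open>L1 F\<close> assms(2)] sum_subtractf[symmetric]
    by (intro sum.cong refl) (simp add: \<delta>_def algebra_simps)
  also have "\<dots> = (\<Sum>z\<in>S. real q * ((\<delta> z + sum \<delta> (Cl z)) * \<delta> z))"
  proof (rule sum.cong[OF refl])
    fix z assume z: "z \<in> S"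
    have "F z - F u0 = (\<theta> (rel x z) - \<theta> (rel x u0)) - (\<theta> (rel y z) - \<theta> (rel y u0))"
      using assms(1,2) base z S_in_X rel_sym by (simp add: F_def)
    also have "\<dots> = real q * (\<delta> z + sum \<delta> (Cl z))"
      unfolding kernel_diff[OF z assms(1)] kernel_diff[OF z assms(2)]
      by (simp add: \<delta>_def sum_subtractf algebra_simps)
    finally show "(F z - F u0) * \<delta> z = real q * ((\<delta> z + sum \<delta> (Cl z)) * \<delta> z)" by simp
  qed
  finally show ?thesis by (simp add: sum_distrib_left)
qed

definition m :: nat where "m = card (Cl ` S)"

definition cl :: "nat \<Rightarrow> 'a set" where
  "cl = (SOME h. bij_betw h {..<m} (Cl ` S))"

definition pt :: "nat \<Rightarrow> nat \<Rightarrow> 'a" where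
  "pt i = (SOME h. bij_betw h {1..<q} (cl i))"

text \<open>The digit 0 stands for the base vertex of the clique.\<close>
definition dig :: "nat \<Rightarrow> 'a \<Rightarrow> nat" where
  "dig i x = (if \<exists>c\<in>{1..<q}. x \<in> Y (pt i c) then THE c. c \<in> {1..<q} \<and> x \<in> Y (pt i c) else 0)"

lemma bij_cl: "bij_betw cl {..<m} (Cl ` S)"
proof -
  have "\<exists>h. bij_betw h {..<m} (Cl ` S)"
    using ex_bij_betw_nat_finite[of "Cl ` S"] by (simp add: m_def lessThan_atLeast0)
  then show ?thesis unfolding cl_def by (rule someI_ex)
qed

lemma cl_class:
  assumes "i < m"
  obtains z where "z \<in> S" "cl i = Cl z"
proof -
  have "cl i \<in> Cl ` S" using bij_betwE[OF bij_cl] assms by blast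
  then show ?thesis using that by blast
qed

lemma bij_pt:
  assumes "i < m"
  shows "bij_betw (pt i) {1..<q} (cl i)"
proof -
  obtain z where z: "z \<in> S" "cl i = Cl z" using cl_class assms .
  then have "card {1..<q} = card (cl i)" using card_Cl by (simp add: q_def)
  then have "\<exists>h. bij_betw h {1..<q} (cl i)"
    using z Cl_subset by (intro finite_same_card_bij) auto
  then show ?thesis unfolding pt_def by (rule someI_ex)
qed

lemma pt_S: "i < m \<Longrightarrow> c \<in> {1..<q} \<Longrightarrow> pt i c \<in> S"
  and Cl_pt: "i < m \<Longrightarrow> c \<in> {1..<q} \<Longrightarrow> Cl (pt i c) = cl i"
proof -
  have *: "pt i c \<in> S \<and> Cl (pt i c) = cl i" if i: "i < m" and c: "c \<in> {1..<q}"
  proof -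
    obtain z where z: "z \<in> S" "cl i = Cl z" using cl_class i .
    have "pt i c \<in> Cl z" using bij_betwE[OF bij_pt[OF i]] c z by blast
    then show ?thesis using z Cl_eq Cl_subset by blast
  qed
  then show "i < m \<Longrightarrow> c \<in> {1..<q} \<Longrightarrow> pt i c \<in> S"
    "i < m \<Longrightarrow> c \<in> {1..<q} \<Longrightarrow> Cl (pt i c) = cl i" by blast+
qed

lemma S_is_pt:
  assumes "z \<in> S"
  obtains i c where "i < m" "c \<in> {1..<q}" "z = pt i c"
proof -
  have "Cl z \<in> cl ` {..<m}" using bij_cl assms by (simp add: bij_betw_def)
  then obtain i where i: "i < m" "cl i = Cl z" by auto
  then have "z \<in> pt i ` {1..<q}" using bij_pt[OF i(1)] Cl_self[OF assms] by (simp add: bij_betw_def)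
  then show ?thesis using that i by blast
qed

lemma sum_cl: "i < m \<Longrightarrow> sum g (cl i) = (\<Sum>c\<in>{1..<q}. g (pt i c))"
  using sum.reindex_bij_betw[OF bij_pt, of i g] by simp

lemma sum_S: "(\<Sum>z\<in>S. g z) = (\<Sum>i<m. \<Sum>c\<in>{1..<q}. g (pt i c))"
proof -
  have "S = \<Union> (Cl ` S)" using Cl_self Cl_subset by blast
  then have "sum g S = sum g (\<Union> (Cl ` S))" by simp
  also have "\<dots> = (\<Sum>C\<in>Cl ` S. sum g C)"
  proof (subst sum.Union_disjoint)
    show "\<forall>A\<in>Cl ` S. finite A" using Cl_subset by blast
    show "\<forall>A\<in>Cl ` S. \<forall>B\<in>Cl ` S. A \<noteq> B \<longrightarrow> A \<inter> B = {}"
    proof (intro ballI impI)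
      fix A B assume AB: "A \<in> Cl ` S" "B \<in> Cl ` S" "A \<noteq> B"
      then obtain y z where yz: "y \<in> S" "z \<in> S" "A = Cl y" "B = Cl z" by blast
      show "A \<inter> B = {}" using Cl_eq[OF yz(1)] Cl_eq[OF yz(2)] yz(3,4) AB(3) by blast
    qed
  qed simp
  also have "\<dots> = (\<Sum>i<m. sum g (cl i))"
    by (rule sum.reindex_bij_betw[OF bij_cl, symmetric])
  also have "\<dots> = (\<Sum>i<m. \<Sum>c\<in>{1..<q}. g (pt i c))"
    using sum_cl by (intro sum.cong) auto
  finally show ?thesis .
qed

lemma Y_pt_disjoint:
  assumes "i < m" "c \<in> {1..<q}" "c' \<in> {1..<q}" "x \<in> Y (pt i c)" "x \<in> Y (pt i c')"
  shows "c = c'"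
proof (rule ccontr)
  assume "c \<noteq> c'"
  then have "pt i c' \<noteq> pt i c"
    using bij_pt[OF assms(1)] assms(2,3) by (auto simp: bij_betw_def inj_on_def)
  moreover have "pt i c' \<in> Cl (pt i c)"
    using Cl_pt[OF assms(1,2)] Cl_pt[OF assms(1,3)] Cl_self[OF pt_S[OF assms(1,3)]] by simp
  ultimately show False using Y_disjoint[OF pt_S[OF assms(1,2)]] assms(4,5) by blast
qed

lemma Y_dig:
  assumes "i < m" "c \<in> {1..<q}"
  shows "x \<in> Y (pt i c) \<longleftrightarrow> dig i x = c"
proof
  assume x: "x \<in> Y (pt i c)"
  then have "(THE c. c \<in> {1..<q} \<and> x \<in> Y (pt i c)) = c"
    using assms Y_pt_disjoint[OF assms(1)] by (intro the_equality) blast+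
  moreover have "\<exists>c\<in>{1..<q}. x \<in> Y (pt i c)" using x assms by blast
  ultimately show "dig i x = c" by (simp only: dig_def if_True)
next
  assume d: "dig i x = c"
  then obtain c' where c': "c' \<in> {1..<q}" "x \<in> Y (pt i c')"
    using assms by (auto simp: dig_def split: if_splits)
  then have "(THE c. c \<in> {1..<q} \<and> x \<in> Y (pt i c)) = c'"
    using Y_pt_disjoint[OF assms(1)] by (intro the_equality) blast+
  moreover have "\<exists>c\<in>{1..<q}. x \<in> Y (pt i c)" using c' by blast
  ultimately have "dig i x = c'" by (simp only: dig_def if_True)
  then show "x \<in> Y (pt i c)" using c' d by simp
qed

lemma dig_less:
  assumes "i < m"
  shows "dig i x < q"
proof (cases "\<exists>c\<in>{1..<q}. x \<in> Y (pt i c)")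
  case True
  then obtain c where "c \<in> {1..<q}" "x \<in> Y (pt i c)" by blast
  then show ?thesis using Y_dig[OF assms, of c x] by simp
next
  case False
  then show ?thesis using q_pos by (simp add: dig_def)
qed

lemma dig_u0: "dig i u0 = 0"
  using u0_notin_Y by (simp add: dig_def)

text \<open>For an edge the energy is \<open>2q\<close>, and every clique whose digit changes
  contributes \<open>2q\<close> to it, so there is exactly one.\<close>

lemma dig_edge:
  assumes "x \<in> X" "y \<in> X" "rel x y = 1"
  shows "card {i. i < m \<and> dig i x \<noteq> dig i y} = 1"
proof -
  define \<delta> :: "'a \<Rightarrow> real" where "\<delta> z = of_bool (x \<in> Y z) - of_bool (y \<in> Y z)" for z
  have block: "(\<Sum>c\<in>{1..<q}. (\<delta> (pt i c) + sum \<delta> (Cl (pt i c))) * \<delta> (pt i c)) = 2 * of_bool (dig i x \<noteq> dig i y)"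
    if i: "i < m" for i
  proof -
    define s t where "s = dig i x" and "t = dig i y"
    have st: "s < q" "t < q" using dig_less i by (auto simp: s_def t_def)
    have \<delta>: "\<delta> (pt i c) = of_bool (s = c) - of_bool (t = c)" if "c \<in> {1..<q}" for c
      using Y_dig[OF i that] by (simp add: \<delta>_def s_def t_def)
    have one: "(\<Sum>c\<in>{1..<q}. of_bool (r = c)) = (of_bool (r \<noteq> 0) :: real)" if "r < q" for r
      using that by (auto simp: of_bool_def)
    have tot: "sum \<delta> (cl i) = of_bool (s \<noteq> 0) - of_bool (t \<noteq> 0)"
      unfolding sum_cl[OF i] using \<delta> one st by (simp add: sum_subtractf)
    have "(\<Sum>c\<in>{1..<q}. \<delta> (pt i c) * \<delta> (pt i c)) =
        (\<Sum>c\<in>{1..<q}. of_bool (s = c) + of_bool (t = c) - 2 * (of_bool (s = t) * of_bool (s = c)))"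
      using \<delta> by (intro sum.cong refl) (auto simp: of_bool_def)
    also have "\<dots> = of_bool (s \<noteq> 0) + of_bool (t \<noteq> 0) - 2 * (of_bool (s = t) * of_bool (s \<noteq> 0))"
      using one st by (simp add: sum.distrib sum_subtractf flip: sum_distrib_left)
    finally have sq: "(\<Sum>c\<in>{1..<q}. \<delta> (pt i c) * \<delta> (pt i c)) =
       of_bool (s \<noteq> 0) + of_bool (t \<noteq> 0) - 2 * (of_bool (s = t) * of_bool (s \<noteq> 0))" .
    have "(\<Sum>c\<in>{1..<q}. (\<delta> (pt i c) + sum \<delta> (Cl (pt i c))) * \<delta> (pt i c)) =
        (\<Sum>c\<in>{1..<q}. \<delta> (pt i c) * \<delta> (pt i c) + sum \<delta> (cl i) * \<delta> (pt i c))"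
      using Cl_pt[OF i] by (intro sum.cong) (auto simp: distrib_right)
    also have "\<dots> = (\<Sum>c\<in>{1..<q}. \<delta> (pt i c) * \<delta> (pt i c)) + sum \<delta> (cl i) * sum \<delta> (cl i)"
      unfolding sum.distrib sum_distrib_left[symmetric] sum_cl[OF i, symmetric] ..
    \<comment> \<open>For \<open>s \<noteq> t\<close>, squares plus squared sum are 2 + 0 if both
      digits are nonzero, and 1 + 1 if one of them is 0.\<close>
    also have "\<dots> = 2 * of_bool (s \<noteq> t)" unfolding sq tot by (auto simp: of_bool_def)
    finally show ?thesis by (simp add: s_def t_def)
  qed
  have "2 * real q = 2 * (\<theta> 0 - \<theta> (rel x y))" using assms \<theta>_0 \<theta>_1 by simp
  also have "\<dots> = real q * (\<Sum>z\<in>S. (\<delta> z + sum \<delta> (Cl z)) * \<delta> z)"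
    unfolding \<delta>_def using assms by (intro edge_energy)
  also have "(\<Sum>z\<in>S. (\<delta> z + sum \<delta> (Cl z)) * \<delta> z) = (\<Sum>i<m. 2 * of_bool (dig i x \<noteq> dig i y))"
    unfolding sum_S using block by (intro sum.cong) auto
  also have "\<dots> = 2 * real (card {i \<in> {..<m}. dig i x \<noteq> dig i y})"
    by (simp add: of_bool_def sum.If_cases Int_def flip: sum_distrib_left)
  finally have "real (card {i \<in> {..<m}. dig i x \<noteq> dig i y}) = 1" using q_pos by simp
  then show ?thesis by simp
qed

text \<open>A nonzero \<open>c\<close> means that \<open>x\<close> lies outside the corresponding
  \<open>Y\<close>. For \<open>c = 0\<close> the remaining neighbours are counted:
  \<open>K - b - a = 1\<close>.\<close>

lemma card_dig_nb:
  assumes "x \<in> X" "i < m" "c < q" "c \<noteq> dig i x"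
  shows "card {y \<in> nb x. dig i y = c} = 1"
proof -
  have eq: "{y \<in> nb x. dig i y = c} = nb x \<inter> Y (pt i c)" if "c \<in> {1..<q}" for c
    using Y_dig[OF assms(2) that] by auto
  have nonzero: "card {y \<in> nb x. dig i y = c} = 1" if "c \<in> {1..<q}" "c \<noteq> dig i x" for c
    unfolding eq[OF that(1)] using that Y_dig assms(1,2) by (intro card_nb_Y_outside pt_S) auto
  show ?thesis
  proof (cases "c = 0")
    case False
    then show ?thesis using nonzero assms by simp
  next
    case True
    define s where "s = dig i x"
    have s: "s \<in> {1..<q}" using assms dig_less True by (simp add: s_def)
    have "K = card (nb x)" using card_nb assms by simp
    also have "\<dots> = (\<Sum>r<q. card {y \<in> nb x. dig i y = r})"
      using dig_less[OF assms(2)] by (subst card_eq_sum, subst sum.group[symmetric, where g = "dig i" and T = "{..<q}"]) auto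
    also have "\<dots> = (\<Sum>r\<in>insert 0 (insert s ({1..<q} - {s})). card {y \<in> nb x. dig i y = r})"
      using s by (intro sum.cong) auto
    also have "\<dots> = card {y \<in> nb x. dig i y = 0} + (card {y \<in> nb x. dig i y = s} +
        (\<Sum>r\<in>{1..<q} - {s}. card {y \<in> nb x. dig i y = r}))"
      using s by (simp del: insert_Diff_single)
    also have "card {y \<in> nb x. dig i y = s} = b"
      unfolding eq[OF s] using Y_dig[OF assms(2) s] s assms by (intro card_nb_Y_inside pt_S) (auto simp: s_def)
    also have "(\<Sum>r\<in>{1..<q} - {s}. card {y \<in> nb x. dig i y = r}) = (\<Sum>r\<in>{1..<q} - {s}. 1)"
      using nonzero by (intro sum.cong) (auto simp: s_def)
    also have "\<dots> = a" using s by (simp add: q_def)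
    finally show ?thesis unfolding True using K_ge unfolding b_def by linarith
  qed
qed

section \<open>The covering map and the number of coordinates\<close>

sublocale hamming_coordinates X rel u0 m q dig
proof
  show "u0 \<in> X" by (rule base)
  fix x y i assume x: "x \<in> X"
  show "walk X rel (rel x y) x y" if "y \<in> X" using walk_rel x that .
  show "rel x y \<le> n" if "y \<in> X" "walk X rel n x y" for n using rel_le_walk x that .
  show "rel x y = rel y x" if "y \<in> X" using rel_sym x that .
  show "dig i x < q" if "i < m" using dig_less that .
  show "card {i. i < m \<and> dig i x \<noteq> dig i y} = 1" if "y \<in> X" "rel x y = 1" using dig_edge x that .
  show "\<exists>!y. y \<in> X \<and> rel x y = 1 \<and> dig i y = c" if c: "i < m" "c < q" "c \<noteq> dig i x" for c
  proof -
    obtain w where "{y \<in> nb x. dig i y = c} = {w}"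
      using card_dig_nb[OF x c] by (rule card_1_singletonE)
    then have "y \<in> X \<and> rel x y = 1 \<and> dig i y = c \<longleftrightarrow> y = w" for y
      unfolding nb_def by blast
    then show ?thesis by simp
  qed
next
  \<comment> \<open>The first vertex \<open>z\<close> on a geodesic from \<open>u0\<close> to
    \<open>y\<close> satisfies \<open>y \<in> Y z\<close>, which makes a digit of \<open>y\<close>
    nonzero.\<close>
  fix y assume y: "y \<in> X" and dig: "\<And>i. i < m \<Longrightarrow> dig i y = dig i u0"
  show "y = u0"
  proof (rule ccontr)
    assume "y \<noteq> u0"
    then obtain n where n: "rel u0 y = Suc n" using rel_0[OF base y] by (cases "rel u0 y") auto
    then obtain z where z: "z \<in> X" "rel u0 z = 1" "walk X rel n z y"
      using walk_rel[OF base y] by auto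
    have zS: "z \<in> S" using z by (simp add: S_def nb_def)
    have "rel z y \<le> n" using rel_le_walk z y by blast
    moreover have "rel u0 y \<le> Suc (rel z y)"
      using rel_le_walk[OF base y, of "Suc (rel z y)"] walk_rel[OF z(1) y] z by auto
    ultimately have "y \<in> Y z" using n y by (simp add: Y_def)
    obtain i c where ic: "i < m" "c \<in> {1..<q}" "z = pt i c" using S_is_pt zS .
    then have "dig i y = c" using \<open>y \<in> Y z\<close> Y_dig by blast
    then show False using dig[OF ic(1)] ic(2) dig_u0 by simp
  qed
qed

text \<open>Distance \<open>d\<close> occurs and Hamming distances are at most \<open>m\<close>;
  conversely a vertex with all digits 1 is at distance \<open>m\<close> from
  \<open>u0\<close>.\<close>

lemma m_eq_d: "m = d"
proof (rule antisym)
  obtain x y where "x \<in> X" "y \<in> X" "rel x y = d" using rel_occurs[of d] by auto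
  then have "d = card {i. i < m \<and> dig i x \<noteq> dig i y}" using rel_eq_ham by (simp add: ham_def)
  also have "\<dots> \<le> card {..<m}" by (rule card_mono) auto
  finally show "d \<le> m" by simp
  obtain y where y: "y \<in> X" "\<forall>i<m. dig i y = 1"
    using dig_surj_prefix[of "\<lambda>_. 1" m] q_pos by auto
  then have "{i. i < m \<and> dig i u0 \<noteq> dig i y} = {..<m}" using dig_u0 by auto
  then have "rel u0 y = m" using rel_eq_ham[OF base y(1)] by (simp add: ham_def)
  then show "m \<le> d" using rel_le[OF base y(1)] by simp
qed

end

theorem theorem3p2:
  fixes X :: "'a set" and d :: nat and rel :: "'a \<Rightarrow> 'a \<Rightarrow> nat" and u0 :: 'a
    and E :: "nat \<Rightarrow> 'a \<Rightarrow> 'a \<Rightarrow> real" and P :: "nat \<Rightarrow> nat \<Rightarrow> real"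
  assumes "P_polynomial X d rel"
    and "formally_self_dual_ordering X d rel E P"
    and "u0 \<in> X"
    and "subspace_sum (Hom X rel u0 0) (Hom X rel u0 1) = subspace_sum (Lspace X E 0) (Lspace X E 1)"
    and "d \<ge> 6"
  shows "\<exists>q. iso_Hamming X d rel q"
proof -
  interpret homogeneous_self_dual X d rel u0 E P
    using assms by unfold_locales auto
  show ?thesis using iso_Hamming m_eq_d by auto
qed

end
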